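(* Let $\ell\in\frac12\mathbb{N}$ and let $P_n$ be the monic matrix-valued orthogonal polynomials with respect to the weight $W$ defined in the context. The squared norm matrix $H_n=\int_{-1}^1P_n(x)W(x)P_n(x)^*\,dx$ is given, for all $n\ge 0$ and $i,j\in\{0,\dots,2\ell\}$, by $$(H_n)_{ij}=\delta_{ij}\,\frac\pi2\,\frac{(n!)^2\,(2\ell+1)_{n+1}^2}{(i+1)_n^2\,(2\ell-i+1)_n^2}\,\frac{2^{-2n}}{(n+i+1)(2\ell-i+n+1)},$$ and $JH_nJ=H_n$, where $J_{nm}=\delta_{n+m,2\ell}$.
   Context: $\mathbb{N}=\{0,1,2,\dots\}$; matrices are $(2\ell+1)\times(2\ell+1)$, indexed by $0,\dots,2\ell$; $(a)_k$ is the Pochhammer symbol and $(a)_k^2=((a)_k)^2$; $U_r$ is the Chebyshev polynomial of the second kind. For $0\le m\le n\le2\ell$, $x\in[-1,1]$, $$W(x)_{n,m}=\sqrt{1-x^2}\sum_{t=0}^m\alpha_t(m,n)U_{n+m-2t}(x),\quad \alpha_t(m,n)=\frac{2\ell+1}{n+1}\frac{(2\ell-m)!\,m!}{(2\ell)!}(-1)^{m-t}\frac{(n-2\ell)_{m-t}}{(n+2)_{m-t}}\frac{(2\ell+2-t)_t}{t!},$$ and $W(x)_{n,m}=W(x)_{m,n}$ for $n<m$; $W$ is positive definite almost everywhere. $P_n$ is the unique matrix-valued polynomial of degree $n$ with leading coefficient $I$ such that $\int_{-1}^1P_n(x)W(x)P_m(x)^*dx=0$ for $n\ne m$. *)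

theory Defs
  imports
    "HOL-Analysis.Henstock_Kurzweil_Integration"
    "HOL-Computational_Algebra.Polynomial"
    "Jordan_Normal_Form.Schur_Decomposition"
begin

text \<open>
  The half-integer \<open>\<ell>\<close> enters only through \<open>2\<ell>\<close>, so it is represented throughout by the natural
  number \<open>N = 2\<ell>\<close>. Matrices have size \<open>N + 1\<close> and are indexed by \<open>0, \<dots>, N\<close>.
\<close>

fun cheb_U :: "nat \<Rightarrow> real poly" where
  "cheb_U 0 = 1"
| "cheb_U (Suc 0) = [:0, 2:]"
| "cheb_U (Suc (Suc r)) = [:0, 2:] * cheb_U (Suc r) - cheb_U r"

text \<open>Only used for \<open>t \<le> m \<le> n \<le> N\<close>, so that the natural subtractions are exact; the base
  \<open>n - N\<close> of the first Pochhammer symbol is a difference of reals and may be negative.\<close>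

definition alpha :: "nat \<Rightarrow> nat \<Rightarrow> nat \<Rightarrow> nat \<Rightarrow> real" where
  "alpha N t m n =
     (real N + 1) / (real n + 1) * (fact (N - m) * fact m / fact N) * (- 1) ^ (m - t)
     * (pochhammer (real n - real N) (m - t) / pochhammer (real n + 2) (m - t))
     * (pochhammer (real N + 2 - real t) t / fact t)"

definition weight_entry :: "nat \<Rightarrow> real \<Rightarrow> nat \<Rightarrow> nat \<Rightarrow> real" where
  "weight_entry N x n m =
     sqrt (1 - x\<^sup>2) * (\<Sum>t = 0..m. alpha N t m n * poly (cheb_U (n + m - 2 * t)) x)"

definition weight :: "nat \<Rightarrow> real \<Rightarrow> complex mat" where
  "weight N x = mat (N + 1) (N + 1)
     (\<lambda>(n, m). complex_of_real (if m \<le> n then weight_entry N x n m else weight_entry N x m n))"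

text \<open>A matrix-valued polynomial is encoded as a matrix of polynomials.\<close>

definition mpoly_eval :: "complex poly mat \<Rightarrow> real \<Rightarrow> complex mat" where
  "mpoly_eval P x = map_mat (\<lambda>p. poly p (complex_of_real x)) P"

definition mpoly_coeff :: "complex poly mat \<Rightarrow> nat \<Rightarrow> complex mat" where
  "mpoly_coeff P k = map_mat (\<lambda>p. coeff p k) P"

definition monic_mpoly :: "nat \<Rightarrow> nat \<Rightarrow> complex poly mat \<Rightarrow> bool" where
  "monic_mpoly d n P \<longleftrightarrow>
     P \<in> carrier_mat d d \<and> mpoly_coeff P n = 1\<^sub>m d \<and> (\<forall>k>n. mpoly_coeff P k = 0\<^sub>m d d)"

definition mat_integral :: "nat \<Rightarrow> (real \<Rightarrow> complex mat) \<Rightarrow> complex mat" where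
  "mat_integral d F = mat d d (\<lambda>(i, j). integral {-1..1} (\<lambda>x. F x $$ (i, j)))"

definition mpoly_inner :: "nat \<Rightarrow> complex poly mat \<Rightarrow> complex poly mat \<Rightarrow> complex mat" where
  "mpoly_inner N P Q =
     mat_integral (N + 1) (\<lambda>x. mpoly_eval P x * weight N x * mat_adjoint (mpoly_eval Q x))"

definition monic_MVOP :: "nat \<Rightarrow> (nat \<Rightarrow> complex poly mat) \<Rightarrow> bool" where
  "monic_MVOP N P \<longleftrightarrow>
     (\<forall>n. monic_mpoly (N + 1) n (P n)) \<and>
     (\<forall>n m. n \<noteq> m \<longrightarrow> mpoly_inner N (P n) (P m) = 0\<^sub>m (N + 1) (N + 1))"

definition sq_norm :: "nat \<Rightarrow> (nat \<Rightarrow> complex poly mat) \<Rightarrow> nat \<Rightarrow> complex mat" where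
  "sq_norm N P n = mpoly_inner N (P n) (P n)"

definition flip_mat :: "nat \<Rightarrow> complex mat" where
  "flip_mat N = mat (N + 1) (N + 1) (\<lambda>(n, m). if n + m = N then 1 else 0)"

end

theory Submission
  imports Defs
begin

text \<open>
  \<^bold>\<open>Idea.\<close> Write \<open>R\<^sub>n\<close> for the monic orthogonal polynomials, with rows \<open>R\<^sub>n\<^sub>,\<^sub>i\<close>. They come from
  matrix-valued spherical functions on \<open>SU(2) \<times> SU(2)\<close>, which suggests a three-term recurrence
  \<open>x R\<^sub>n\<^sub>,\<^sub>i = R\<^sub>n\<^sub>+\<^sub>1\<^sub>,\<^sub>i + a R\<^sub>n\<^sub>,\<^sub>i\<^sub>+\<^sub>1 + b R\<^sub>n\<^sub>,\<^sub>i\<^sub>-\<^sub>1 + c R\<^sub>n\<^sub>-\<^sub>1\<^sub>,\<^sub>i\<close> with explicit rational \<open>a, b, c\<close>. Here the rows are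
  \<^emph>\<open>defined\<close> by this recurrence (\<open>mvop_row\<close>), and orthogonality is proved without knowing the
  polynomials themselves, from their moments against the weight
  \<open>M(n,i,j,k) = \<integral> (R\<^sub>n W)\<^sub>i\<^sub>j U\<^sub>k dx\<close>.

  For \<open>n = 0\<close> these are \<open>\<pi>/2\<close> times the coefficients \<open>\<alpha>\<^sub>t\<close> of the weight, because the \<open>U\<^sub>k\<close> are orthogonal for
  \<open>sqrt (1 - x\<^sup>2)\<close>. In general the spherical functions make them, up to normalisation, squares of
  Racah 6j-symbols with one stretched triad, and such a symbol is a single product of factorials:
  with \<open>k = n + i + j - 2t\<close>,
  \<open>M = C(n,i,j) (n+i-t)! (n+j-t)! / (t! (i-t)! (j-t)! (n+i+j+1-t)! (N-i-j+t)! (N+n+1-t)!)\<close>.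
  Since \<open>2 x U\<^sub>k = U\<^sub>k\<^sub>+\<^sub>1 + U\<^sub>k\<^sub>-\<^sub>1\<close>, the recurrence of the rows turns into a recurrence of the moments
  in \<open>n, i, k\<close>, and for a product of factorials this is one polynomial identity
  (\<open>racah_term_recurrence\<close>, \<open>cheb_moment_recurrence\<close>). This proves the closed form by induction
  on \<open>n\<close> (\<open>row_form_mvop_row\<close>).

  The product vanishes for \<open>t > min i j\<close>, that is, for \<open>k < n + \<bar>i - j\<bar>\<close>. Hence \<open>R\<^sub>n\<close> is
  orthogonal to everything of degree below \<open>n\<close>, and its pairing with \<open>U\<^sub>n\<close> is diagonal and explicit.
  For an arbitrary monic orthogonal family \<open>P\<close> the rows of \<open>P\<^sub>n - R\<^sub>n\<close> have degree below \<open>n\<close>, so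
  \<open>\<langle>P\<^sub>n, P\<^sub>n\<rangle> = \<langle>P\<^sub>n, R\<^sub>n\<rangle> = \<langle>R\<^sub>n, P\<^sub>n\<rangle>\<^sup>*\<close>, which only sees the leading coefficient \<open>I\<close> of \<open>P\<^sub>n\<close>
  (\<open>sq_norm_entry\<close>).
\<close>

section \<open>Stretched Racah coefficients\<close>

text \<open>This is \<open>1 / \<Gamma>(z + 1)\<close>. The zeros at the negative integers let one formula cover the whole range
  of summation and its boundary, see \<open>recip_fact_pred\<close>.\<close>

definition recip_fact :: "int \<Rightarrow> real" where
  "recip_fact z = (if z < 0 then 0 else 1 / fact (nat z))"

text \<open>The quotient \<open>(z + n)! / z!\<close>. It is cut off at \<open>z = 0\<close>; the Pochhammer symbol \<open>(z + 1)\<^sub>n\<close> would be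
  nonzero again for \<open>z < - n\<close>.\<close>

definition rise :: "nat \<Rightarrow> int \<Rightarrow> real" where
  "rise n z = (if z < 0 then 0 else fact (n + nat z) / fact (nat z))"

text \<open>For \<open>k = n + i + j - 2t \<ge> 0\<close> and \<open>i, j \<le> N\<close> this is, up to a factor that does not depend on \<open>t\<close>, the
  square of the 6j-symbol with rows \<open>j/2, (N - j)/2, N/2\<close> and \<open>(n + N - i)/2, (n + i)/2, k/2\<close>. Its
  first row is stretched (\<open>N/2\<close> is the sum of the other two spins), so that Racah's alternating sum
  collapses to a single term.\<close>

definition racah_term :: "nat \<Rightarrow> nat \<Rightarrow> int \<Rightarrow> int \<Rightarrow> int \<Rightarrow> real" where
  "racah_term N n i j t =
     rise n (i - t) * rise n (j - t) * recip_fact t * recip_fact (int n + i + j + 1 - t)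
     * recip_fact (int N - i - j + t) * recip_fact (int N + int n + 1 - t)"

lemma recip_fact_pred: "recip_fact (z - 1) = of_int z * recip_fact z"
proof (cases "z \<le> 0")
  case True
  then show ?thesis by (cases "z = 0") (auto simp: recip_fact_def)
next
  case False
  then obtain m where m: "z = int (Suc m)"
    by (metis not_le gr0_conv_Suc zero_less_imp_eq_int)
  have "nat (int (Suc m) - 1) = m" "nat (int (Suc m)) = Suc m" by auto
  then show ?thesis by (simp add: recip_fact_def m del: of_nat_Suc)
qed

lemma rise_Suc: "rise (Suc n) z = (of_int z + real n + 1) * rise n z"
  by (auto simp: rise_def field_simps)

text \<open>The case \<open>z = 0\<close> holds because of the cut-off: both sides vanish.\<close>

lemma rise_Suc_pred:
  assumes "z \<ge> 0"
  shows "rise (Suc n) (z - 1) = of_int z * rise n z"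
proof (cases "z = 0")
  case False
  then obtain m where m: "z = int (Suc m)"
    using assms by (metis gr0_conv_Suc order_le_less zero_less_imp_eq_int)
  have "nat (int (Suc m) - 1) = m" "nat (int (Suc m)) = Suc m" by auto
  then show ?thesis by (simp add: rise_def m del: of_nat_Suc)
qed (simp add: rise_def)

lemma rise_0: "rise 0 z = (if z < 0 then 0 else 1)"
  by (simp add: rise_def)

lemma rise_neg: "z < 0 \<Longrightarrow> rise n z = 0"
  by (simp add: rise_def)

text \<open>What remains of the recurrence of \<open>racah_term\<close> once the common factorials are divided out. The six
  summands are the shifts of \<open>t\<close> (two), \<open>n\<close> (two) and \<open>i\<close> (two).\<close>

lemma racah_polynomial_identity:
  fixes n p q s t :: "'a :: comm_ring_1"
  shows "(n + p + t) * (n + s + q)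
           * (t * s * ((n + p) * (n + q)) + (n + p + q + t) * (n + s + p + q) * p * q)
       = (s + p + q + t + n)\<^sup>2 * ((n + p) * (n + q) * p * q)
         + (p + t)\<^sup>2 * (s * (n + s + p + q) * (n + p) * q)
         + (s + q)\<^sup>2 * (t * (n + p + q + t) * p * (n + q))
         + n\<^sup>2 * (t * (n + p + q + t) * s * (n + s + p + q))"
  by (simp add: algebra_simps power2_eq_square)

text \<open>The four pairs of spins next to \<open>((n + i)/2, (n + N - i)/2)\<close> on the right against the two neighbours of \<open>k/2\<close>
  on the left, now with \<open>k = n + 1 + i + j - 2t\<close>. The hypothesis is \<open>k \<ge> 0\<close>. It is needed: for \<open>n = 0\<close> and
  \<open>i = j = t - 1\<close>, where \<open>k = -1\<close>, the right side vanishes and the left side does not when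
  \<open>0 \<le> i \<le> N\<close>.\<close>

lemma racah_term_recurrence:
  fixes i j t :: int
  assumes k: "2 * t \<le> int n + 1 + i + j"
  shows "of_int ((int n + i + 1) * (int N - i + int n + 1))
           * (racah_term N n i j (t - 1) + racah_term N n i j t)
       = of_int ((int N + int n + 2)\<^sup>2) * racah_term N (Suc n) i j t
         + of_int ((i + 1)\<^sup>2) * racah_term N n (i + 1) j t
         + of_int ((int N - i + 1)\<^sup>2) * racah_term N n (i - 1) j (t - 1)
         + of_int ((int n)\<^sup>2) * racah_term N (n - 1) i j (t - 1)"
proof (cases "i - t + 1 < 0 \<or> j - t + 1 < 0")
  case True
  then show ?thesis by (auto simp: racah_term_def rise_neg)
next
  case False
  \<comment> \<open>All six terms are multiples of \<open>Z\<close> and of values of \<open>rise\<close> at \<open>p, q, p - 1, q - 1\<close>; the arguments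
    below are the largest ones at which \<open>recip_fact\<close> is evaluated.\<close>
  define p q s e f where "p = i - t + 1" and "q = j - t + 1" and "s = int N - i - j + t"
    and "e = int n + i + j + 2 - t" and "f = int N + int n + 2 - t"
  have pq: "p \<ge> 0" "q \<ge> 0" using False by (auto simp: p_def q_def)
  define Z where "Z = recip_fact t * recip_fact e * recip_fact s * recip_fact f"
  have args:
    "i - (t - 1) = p" "i - t = p - 1" "i + 1 - t = p" "i - 1 - (t - 1) = p - 1"
    "j - (t - 1) = q" "j - t = q - 1"
    "int n + i + j + 1 - (t - 1) = e" "int n + i + j + 1 - t = e - 1"
    "int (Suc n) + i + j + 1 - t = e" "int n + (i + 1) + j + 1 - t = e"
    "int n + (i - 1) + j + 1 - (t - 1) = e - 1"
    "int N - i - j + (t - 1) = s - 1" "int N - i - j + t = s"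
    "int N - (i + 1) - j + t = s - 1" "int N - (i - 1) - j + (t - 1) = s"
    "int N + int n + 1 - (t - 1) = f" "int N + int n + 1 - t = f - 1"
    "int N + int (Suc n) + 1 - t = f"
    by (simp_all add: p_def q_def s_def e_def f_def)
  have K1: "racah_term N n i j (t - 1) = of_int (t * s) * (rise n p * rise n q) * Z"
    and K2: "racah_term N n i j t = of_int (e * f) * (rise n (p - 1) * rise n (q - 1)) * Z"
    and K3: "racah_term N (Suc n) i j t = (rise (Suc n) (p - 1) * rise (Suc n) (q - 1)) * Z"
    and K4: "racah_term N n (i + 1) j t = of_int (s * f) * (rise n p * rise n (q - 1)) * Z"
    and K5: "racah_term N n (i - 1) j (t - 1) = of_int (t * e) * (rise n (p - 1) * rise n q) * Z"
    unfolding racah_term_def args recip_fact_pred Z_def by simp_all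
  have i: "i = p + t - 1" and N: "int N = s + p + q + t - 2"
    and e: "e = int n + p + q + t" and f: "f = int n + s + p + q"
    by (auto simp: p_def q_def s_def e_def f_def)
  show ?thesis
  proof (cases n)
    case (Suc m)
    have K6: "racah_term N (n - 1) i j (t - 1)
        = of_int (t * e * s * f) * (rise m p * rise m q) * Z"
    proof -
      have m: "int m + i + j + 1 - (t - 1) = e - 1" "int N + int m + 1 - (t - 1) = f - 1"
        by (simp_all add: e_def f_def Suc)
      show ?thesis
        unfolding racah_term_def args Suc diff_Suc_1 m recip_fact_pred Z_def by simp
    qed
    \<comment> \<open>Every value of \<open>rise\<close> is now a polynomial multiple of \<open>rise m\<close>, even at the boundary \<open>p = 0\<close> or
      \<open>q = 0\<close>, because \<open>rise_Suc_pred\<close> includes \<open>z = 0\<close>.\<close>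
    define Y where "Y = rise m p * rise m q * Z"
    have r: "rise n z = of_int (int n + z) * rise m z"
      "rise n (z - 1) = of_int z * rise m z"
      "rise (Suc n) (z - 1) = of_int z * of_int (int n + z) * rise m z" if "z \<ge> 0" for z
      using rise_Suc_pred[OF that, of m] rise_Suc_pred[OF that, of n] rise_Suc[of m z]
      by (simp_all add: Suc add_ac)
    note r = r[OF pq(1)] r[OF pq(2)]
    have "of_int ((int n + i + 1) * (int N - i + int n + 1)) *
        (of_int (t * s) * of_int ((int n + p) * (int n + q)) + of_int (e * f * p * q))
      = of_int ((int N + int n + 2)\<^sup>2) * of_int ((int n + p) * (int n + q) * p * q)
      + of_int ((i + 1)\<^sup>2) * of_int (s * f * (int n + p) * q)
      + of_int ((int N - i + 1)\<^sup>2) * of_int (t * e * p * (int n + q))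
      + of_int ((int n)\<^sup>2) * (of_int (t * e * s * f) :: real)"
      unfolding of_int_add[symmetric] of_int_mult[symmetric] i N e f of_int_eq_iff
      using racah_polynomial_identity[of "int n" p t s q] by (simp add: add_ac)
    then have "of_int ((int n + i + 1) * (int N - i + int n + 1)) *
        (of_int (t * s) * of_int ((int n + p) * (int n + q)) + of_int (e * f * p * q)) * Y
      = (of_int ((int N + int n + 2)\<^sup>2) * of_int ((int n + p) * (int n + q) * p * q)
      + of_int ((i + 1)\<^sup>2) * of_int (s * f * (int n + p) * q)
      + of_int ((int N - i + 1)\<^sup>2) * of_int (t * e * p * (int n + q))
      + of_int ((int n)\<^sup>2) * of_int (t * e * s * f)) * Y"
      by simp
    moreover have "racah_term N n i j (t - 1) = of_int (t * s) * of_int ((int n + p) * (int n + q)) * Y"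
      unfolding K1 Y_def r of_int_mult by (simp only: mult_ac)
    moreover have "racah_term N n i j t = of_int (e * f * p * q) * Y"
      unfolding K2 Y_def r of_int_mult by (simp only: mult_ac)
    moreover have "racah_term N (Suc n) i j t = of_int ((int n + p) * (int n + q) * p * q) * Y"
      unfolding K3 Y_def r of_int_mult by (simp only: mult_ac)
    moreover have "racah_term N n (i + 1) j t = of_int (s * f * (int n + p) * q) * Y"
      unfolding K4 Y_def r of_int_mult by (simp only: mult_ac)
    moreover have "racah_term N n (i - 1) j (t - 1) = of_int (t * e * p * (int n + q)) * Y"
      unfolding K5 Y_def r of_int_mult by (simp only: mult_ac)
    moreover have "racah_term N (n - 1) i j (t - 1) = of_int (t * e * s * f) * Y"
      unfolding K6 Y_def r of_int_mult by (simp only: mult_ac)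
    ultimately show ?thesis by (simp only: distrib_left distrib_right mult.assoc)
  next
    case 0
    \<comment> \<open>There is no \<open>rise (n - 1)\<close> to divide by, and \<open>rise 0\<close> jumps from 0 to 1 at \<open>z = 0\<close>. So the boundary
      cases are separate identities; \<open>p = q = 0\<close> would be \<open>k = -1\<close>.\<close>
    have r: "rise (Suc n) (z - 1) = of_int z" if "z \<ge> 0" for z
      using rise_Suc_pred[OF that, of n] that by (simp add: 0 rise_0)
    have *: "of_int ((int n + i + 1) * (int N - i + int n + 1)) *
        (of_int (t * s) + of_int (e * f) * (rise n (p - 1) * rise n (q - 1)))
      = of_int ((int N + int n + 2)\<^sup>2) * of_int (p * q)
      + of_int ((i + 1)\<^sup>2) * (of_int (s * f) * rise n (q - 1))
      + of_int ((int N - i + 1)\<^sup>2) * (of_int (t * e) * rise n (p - 1))"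
    proof -
      have "p + q > 0" using k by (auto simp: p_def q_def 0)
      then consider "p \<ge> 1" "q \<ge> 1" | "p = 0" "q \<ge> 1" | "p \<ge> 1" "q = 0"
        using pq by linarith
      then show ?thesis
      proof cases
        case 1
        then have R: "rise n (p - 1) = 1" "rise n (q - 1) = 1" by (auto simp: 0 rise_0)
        show ?thesis
          unfolding R mult_1_right of_int_add[symmetric] of_int_mult[symmetric] i N e f of_int_eq_iff
          using 0 by (simp add: algebra_simps power2_eq_square)
      next
        case 2
        then have R: "rise n (p - 1) = 0" "rise n (q - 1) = 1" by (auto simp: 0 rise_0)
        show ?thesis
          unfolding R unfolding i N e f 0 using 2 by (simp add: algebra_simps power2_eq_square)
      next
        case 3
        then have R: "rise n (p - 1) = 1" "rise n (q - 1) = 0" by (auto simp: 0 rise_0)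
        show ?thesis
          unfolding R unfolding i N e f 0 using 3 by (simp add: algebra_simps power2_eq_square)
      qed
    qed
    have R: "rise n p = 1" "rise n q = 1" using pq by (auto simp: 0 rise_0)
    show ?thesis
      using arg_cong[OF *, of "\<lambda>y. y * Z"]
      unfolding K1 K2 K3 K4 K5 r[OF pq(1)] r[OF pq(2)] R 
      using 0 by (simp add: algebra_simps)
  qed
qed

lemma racah_term_outside:
  assumes "t > i \<or> t > j \<or> t < 0 \<or> t < i + j - int N"
  shows "racah_term N n i j t = 0"
  using assms by (auto simp: racah_term_def rise_def recip_fact_def)

section \<open>Closed form and recurrence of the moments\<close>

text \<open>The factor that makes the moments of monic rows (divided by \<open>\<pi>/2\<close>) out of squared 6j-symbols. Its
  quotients under shifts of \<open>n\<close> and \<open>i\<close> turn the coefficients of \<open>racah_term_recurrence\<close> into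
  those of the three-term recurrence below.\<close>

definition moment_factor :: "nat \<Rightarrow> nat \<Rightarrow> nat \<Rightarrow> nat \<Rightarrow> real" where
  "moment_factor N n i j =
     (fact (N + n + 1) / fact N)\<^sup>2 * (fact j * fact (N - j)) * (fact i * fact (N - i))\<^sup>2
     / (fact (n + i) * fact (N - i + n)) / 2 ^ n"

definition moment :: "nat \<Rightarrow> nat \<Rightarrow> nat \<Rightarrow> nat \<Rightarrow> int \<Rightarrow> real" where
  "moment N n i j t = moment_factor N n i j * racah_term N n (int i) (int j) t"

text \<open>The coefficients of \<open>x R\<^sub>n\<^sub>,\<^sub>i = R\<^sub>n\<^sub>+\<^sub>1\<^sub>,\<^sub>i + a R\<^sub>n\<^sub>,\<^sub>i\<^sub>+\<^sub>1 + b R\<^sub>n\<^sub>,\<^sub>i\<^sub>-\<^sub>1 + c R\<^sub>n\<^sub>-\<^sub>1\<^sub>,\<^sub>i\<close>. They vanish where the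
  neighbour does not exist, namely \<open>a\<close> at \<open>i = N\<close>, \<open>b\<close> at \<open>i = 0\<close> and \<open>c\<close> at \<open>n = 0\<close>; for \<open>n = 0\<close> this
  uses \<open>0 / 0 = 0\<close>. Hence it does not matter what \<open>i - 1\<close> and \<open>n - 1\<close> are at 0.\<close>

definition coeff_up :: "nat \<Rightarrow> nat \<Rightarrow> nat \<Rightarrow> real" where
  "coeff_up N n i = (real N - real i)\<^sup>2 / (2 * (real N - real i + real n) * (real N - real i + real n + 1))"

definition coeff_down :: "nat \<Rightarrow> nat \<Rightarrow> real" where
  "coeff_down n i = (real i)\<^sup>2 / (2 * (real n + real i) * (real n + real i + 1))"

definition coeff_back :: "nat \<Rightarrow> nat \<Rightarrow> nat \<Rightarrow> real" where
  "coeff_back N n i = (real n)\<^sup>2 * (real N + real n + 1)\<^sup>2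
     / (4 * (real n + real i) * (real N - real i + real n) * (real n + real i + 1) * (real N - real i + real n + 1))"

text \<open>This is \<open>racah_term_recurrence\<close> multiplied by \<open>moment_factor\<close>. At \<open>i = N\<close> and at \<open>i = 0\<close> the missing
  neighbour is harmless on both sides: its coefficient is zero here, and its \<open>racah_term\<close> is
  zero there.\<close>

lemma moment_recurrence:
  assumes i: "i \<le> N" and j: "j \<le> N" and k: "2 * t \<le> int n + 1 + int i + int j"
  shows "(moment N n i j (t - 1) + moment N n i j t) / 2
       = moment N (Suc n) i j t
         + coeff_up N n i * moment N n (i + 1) j t
         + coeff_down n i * moment N n (i - 1) j (t - 1)
         + coeff_back N n i * moment N (n - 1) i j (t - 1)"
proof -
  define r where "r = N - i"
  have N: "N = i + r" using i by (simp add: r_def)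
  define F where "F = moment_factor N n i j"
  define D where "D = 2 * ((real n + real i + 1) * (real r + real n + 1))"
  have D: "D > 0" by (simp add: D_def add_pos_nonneg)
  have f1: "D * moment_factor N (Suc n) i j = F * (real N + real n + 2)\<^sup>2"
    by (simp add: moment_factor_def D_def F_def N divide_simps power2_eq_square)
       (simp add: algebra_simps)
  have f2: "D * (coeff_up N n i * moment N n (i + 1) j t)
      = F * ((real i + 1)\<^sup>2 * racah_term N n (int i + 1) (int j) t)"
  proof (cases r)
    case 0
    then have "racah_term N n (int i + 1) (int j) t = 0" using N
      by (intro racah_term_outside) auto
    then show ?thesis using 0 by (simp add: coeff_up_def N)
  next
    case (Suc q)
    have "D * (coeff_up N n i * moment_factor N n (i + 1) j) = F * (real i + 1)\<^sup>2"
      by (simp add: moment_factor_def D_def F_def N coeff_up_def Suc divide_simps power2_eq_square)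
         (simp add: algebra_simps)
    then show ?thesis by (simp add: moment_def add.commute flip: mult.assoc)
  qed
  have f3: "D * (coeff_down n i * moment N n (i - 1) j (t - 1))
      = F * ((real N - real i + 1)\<^sup>2 * racah_term N n (int i - 1) (int j) (t - 1))"
  proof (cases i)
    case 0
    then have "racah_term N n (int i - 1) (int j) (t - 1) = 0"
      by (intro racah_term_outside) auto
    then show ?thesis using 0 by (simp add: coeff_down_def)
  next
    case (Suc q)
    have "D * (coeff_down n i * moment_factor N n (i - 1) j) = F * (real N - real i + 1)\<^sup>2"
      by (simp add: moment_factor_def D_def F_def N coeff_down_def Suc divide_simps power2_eq_square)
         (simp add: algebra_simps)
    moreover have "int (i - 1) = int i - 1" using Suc by simp
    ultimately show ?thesis by (simp add: moment_def flip: mult.assoc)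
  qed
  have f4: "D * (coeff_back N n i * moment N (n - 1) i j (t - 1))
      = F * ((real n)\<^sup>2 * racah_term N (n - 1) (int i) (int j) (t - 1))"
  proof (cases n)
    case 0
    then show ?thesis by (simp add: coeff_back_def)
  next
    case (Suc q)
    have "D * (coeff_back N n i * moment_factor N (n - 1) i j) = F * (real n)\<^sup>2"
      by (simp add: moment_factor_def D_def F_def N coeff_back_def Suc divide_simps power2_eq_square)
         (simp add: algebra_simps)
    then show ?thesis by (simp add: moment_def flip: mult.assoc)
  qed
  have D2: "of_int ((int n + int i + 1) * (int N - int i + int n + 1)) = D / 2"
    by (simp add: D_def N)
  have "D * ((moment N n i j (t - 1) + moment N n i j t) / 2)
      = F * (of_int ((int n + int i + 1) * (int N - int i + int n + 1))
           * (racah_term N n i j (t - 1) + racah_term N n i j t))"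
    unfolding D2 moment_def F_def[symmetric] by (simp add: algebra_simps)
  also have "\<dots> = D * moment N (Suc n) i j t
         + D * (coeff_up N n i * moment N n (i + 1) j t)
         + D * (coeff_down n i * moment N n (i - 1) j (t - 1))
         + D * (coeff_back N n i * moment N (n - 1) i j (t - 1))"
    unfolding racah_term_recurrence[OF k] f2 f3 f4
    unfolding moment_def mult.assoc[symmetric] f1 by (simp add: algebra_simps)
  finally have "D * ((moment N n i j (t - 1) + moment N n i j t) / 2)
      = D * (moment N (Suc n) i j t
         + coeff_up N n i * moment N n (i + 1) j t
         + coeff_down n i * moment N n (i - 1) j (t - 1)
         + coeff_back N n i * moment N (n - 1) i j (t - 1))"
    by (simp only: distrib_left)
  then show ?thesis using D by simp
qed

text \<open>The moments by Chebyshev degree \<open>k\<close> instead of \<open>t\<close>. For \<open>k > n + i + j\<close> the quotient is negative, and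
  \<open>moment\<close> is zero there.\<close>

definition cheb_moment :: "nat \<Rightarrow> nat \<Rightarrow> nat \<Rightarrow> nat \<Rightarrow> nat \<Rightarrow> real" where
  "cheb_moment N n i j k =
     (if even (n + i + j + k) then moment N n i j ((int n + int i + int j - int k) div 2) else 0)"

lemma cheb_moment_eq:
  assumes "int n + int i + int j - int k = 2 * t"
  shows "cheb_moment N n i j k = moment N n i j t"
proof -
  have "even (int (n + i + j + k))" using assms by presburger
  then have "even (n + i + j + k)" by presburger
  then show ?thesis using assms by (simp add: cheb_moment_def)
qed

lemma cheb_moment_odd: "odd (n + i + j + k) \<Longrightarrow> cheb_moment N n i j k = 0"
  by (simp add: cheb_moment_def)

text \<open>The left side mirrors \<open>x U\<^sub>k = (U\<^sub>k\<^sub>+\<^sub>1 + U\<^sub>k\<^sub>-\<^sub>1)/2\<close> with \<open>U\<^sub>-\<^sub>1 = 0\<close>. At \<open>k = 0\<close> the closed form agrees with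
  this convention, since \<open>2t = n + i + j + 1\<close> forces \<open>t > min i j\<close>.\<close>

lemma cheb_moment_recurrence:
  assumes i: "i \<le> N" and j: "j \<le> N"
  shows "(cheb_moment N n i j (k + 1) + (if k = 0 then 0 else cheb_moment N n i j (k - 1))) / 2
       = cheb_moment N (Suc n) i j k
         + coeff_up N n i * cheb_moment N n (i + 1) j k
         + coeff_down n i * cheb_moment N n (i - 1) j k
         + coeff_back N n i * cheb_moment N (n - 1) i j k"
proof (cases "even (n + 1 + i + j + k)")
  case False
  have "coeff_down n i * cheb_moment N n (i - 1) j k = 0"
    using False by (cases i) (auto simp: coeff_down_def cheb_moment_odd)
  moreover have "coeff_back N n i * cheb_moment N (n - 1) i j k = 0"
    using False by (cases n) (auto simp: coeff_back_def cheb_moment_odd)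
  moreover have "(if k = 0 then 0 else cheb_moment N n i j (k - 1)) = 0"
    using False by (cases k) (auto simp: cheb_moment_odd)
  moreover have "cheb_moment N n i j (k + 1) = 0" "cheb_moment N (Suc n) i j k = 0"
    "cheb_moment N n (i + 1) j k = 0"
    using False by (auto intro: cheb_moment_odd)
  ultimately show ?thesis by (simp only: add_0_left add_0_right div_0 mult_zero_right)
next
  case True
  then have "even (int n + 1 + int i + int j - int k)" by presburger
  then obtain t where t: "int n + 1 + int i + int j - int k = 2 * t" by blast
  have 1: "cheb_moment N n i j (k + 1) = moment N n i j (t - 1)"
    using t by (intro cheb_moment_eq) simp
  have 2: "(if k = 0 then 0 else cheb_moment N n i j (k - 1)) = moment N n i j t"
  proof (cases "k = 0")
    case True
    have "racah_term N n (int i) (int j) t = 0"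
      using t True by (intro racah_term_outside) linarith
    then show ?thesis using True by (simp add: moment_def)
  next
    case False
    then show ?thesis using t cheb_moment_eq[of n i j "k - 1" t] by simp
  qed
  have 3: "cheb_moment N (Suc n) i j k = moment N (Suc n) i j t"
    using t by (intro cheb_moment_eq) simp
  have 4: "cheb_moment N n (i + 1) j k = moment N n (i + 1) j t"
    using t by (intro cheb_moment_eq) simp
  have 5: "coeff_down n i * cheb_moment N n (i - 1) j k = coeff_down n i * moment N n (i - 1) j (t - 1)"
    using t by (cases i) (auto simp: coeff_down_def intro!: cheb_moment_eq)
  have 6: "coeff_back N n i * cheb_moment N (n - 1) i j k = coeff_back N n i * moment N (n - 1) i j (t - 1)"
    using t by (cases n) (auto simp: coeff_back_def intro!: cheb_moment_eq)
  show ?thesis unfolding 1 2 3 4 5 6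
    using t by (intro moment_recurrence i j) simp
qed

text \<open>A degree \<open>k < n\<close> forces \<open>2t > i + j\<close>, hence \<open>t > min i j\<close>. This is the orthogonality.\<close>

lemma cheb_moment_less:
  assumes "k < n"
  shows "cheb_moment N n i j k = 0"
proof (cases "even (n + i + j + k)")
  case True
  then have "even (int n + int i + int j - int k)" by presburger
  then obtain t where t: "int n + int i + int j - int k = 2 * t" by blast
  have "racah_term N n (int i) (int j) t = 0"
    using t assms by (intro racah_term_outside) linarith
  then show ?thesis using cheb_moment_eq[OF t] by (simp add: moment_def)
qed (simp add: cheb_moment_odd)

lemma pochhammer_of_nat_plus_1: "pochhammer (real m + 1) k = fact (m + k) / fact m"
  using pochhammer_product[of m "m + k" "1::real"]
  by (simp add: pochhammer_fact[symmetric] add.commute)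

text \<open>At \<open>k = n\<close> one has \<open>2t = i + j\<close>, and \<open>t \<le> min i j\<close> leaves only \<open>t = i = j\<close>. The value is \<open>2 ^ n\<close> times
  the claimed norm without its factor \<open>\<pi>/2\<close>, as \<open>U\<^sub>n\<close> has leading coefficient \<open>2 ^ n\<close>.\<close>

lemma cheb_moment_diag:
  assumes "i \<le> N"
  shows "cheb_moment N n i j n = (if i = j then
      2 ^ n * ((fact n)\<^sup>2 * (pochhammer (real N + 1) (n + 1))\<^sup>2
             / ((pochhammer (real i + 1) n)\<^sup>2 * (pochhammer (real N - real i + 1) n)\<^sup>2)
          * (2 powi (- 2 * int n) / ((real n + real i + 1) * (real N - real i + real n + 1)))) else 0)"
proof (cases "i = j")
  case True
  define r where "r = N - i"
  have N: "N = i + r" using assms by (simp add: r_def)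
  have p: "(2::real) powi (- 2 * int n) = 1 / (2 ^ n * 2 ^ n)"
  proof -
    have "(2::real) powi (- 2 * int n) = 2 powi (- int (n + n))" by simp
    also have "\<dots> = inverse (2 ^ (n + n))" by (simp only: power_int_minus power_int_of_nat)
    finally show ?thesis by (simp add: power_add inverse_eq_divide)
  qed
  have "cheb_moment N n i j n = moment N n i i (int i)"
    using True by (simp add: cheb_moment_eq)
  also have "\<dots> = 2 ^ n * ((fact n)\<^sup>2 * (pochhammer (real N + 1) (n + 1))\<^sup>2
             / ((pochhammer (real i + 1) n)\<^sup>2 * (pochhammer (real r + 1) n)\<^sup>2)
          * (2 powi (- 2 * int n) / ((real n + real i + 1) * (real r + real n + 1))))"
  proof -
    have R: "racah_term N n (int i) (int i) (int i)
       = (fact n)\<^sup>2 / (fact i * (fact (n + i) * (real n + real i + 1)) * fact r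
           * (fact (r + n) * (real r + real n + 1)))"
    proof -
      have "recip_fact (int n + int i + int i + 1 - int i) = 1 / (fact (n + i) * (real n + real i + 1))"
      proof -
        have "nat (int n + int i + int i + 1 - int i) = Suc (n + i)" by simp
        then show ?thesis by (simp add: recip_fact_def algebra_simps)
      qed
      moreover have "recip_fact (int N + int n + 1 - int i) = 1 / (fact (r + n) * (real r + real n + 1))"
      proof -
        have "nat (int N + int n + 1 - int i) = Suc (r + n)" using N by simp
        then show ?thesis using N by (simp add: recip_fact_def algebra_simps)
      qed
      moreover have "recip_fact (int N - int i - int i + int i) = 1 / fact r"
        using N by (simp add: recip_fact_def)
      ultimately show ?thesis
        by (simp add: racah_term_def rise_def recip_fact_def power2_eq_square)
    qed
    have *: "A\<^sup>2 * (x * y) * (x * y)\<^sup>2 / (u * v) / w * (m\<^sup>2 / (x * (u * e) * y * (v * g)))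
        = w * (m\<^sup>2 * A\<^sup>2 / ((u / x)\<^sup>2 * (v / y)\<^sup>2) * (1 / (w * w) / (e * g)))"
      if "x \<noteq> 0" "y \<noteq> 0" "w \<noteq> 0" for A x y u v w m e g :: real
      using that by (simp add: divide_simps power2_eq_square)
    have r: "N - i = r" "i + n = n + i" "N + (n + 1) = N + n + 1" using N by simp_all
    show ?thesis
      unfolding moment_def moment_factor_def R pochhammer_of_nat_plus_1 p r
      by (rule *) simp_all
  qed
  finally show ?thesis using True N by simp
next
  case False
  show ?thesis
  proof (cases "even (i + j)")
    case True
    then have "even (int n + int i + int j - int n)" by simp
    then obtain t where t: "int n + int i + int j - int n = 2 * t" by blast
    have "racah_term N n (int i) (int j) t = 0"
      using t False by (intro racah_term_outside) linarith
    then show ?thesis using False cheb_moment_eq[OF t] by (simp add: moment_def)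
  next
    case odd: False
    then have "odd (n + i + j + n)" by presburger
    then show ?thesis using False by (simp add: cheb_moment_odd)
  qed
qed

lemma moment_0_commute: "moment N 0 i j t = moment N 0 j i t"
  by (simp add: moment_def moment_factor_def racah_term_def power2_eq_square mult_ac add_ac diff_diff_eq)

text \<open>The start of the induction. Reflecting the Pochhammer symbol \<open>(n - N)\<^sub>m\<^sub>-\<^sub>t\<close> of \<open>alpha\<close> absorbs its sign and
  leaves a product of factorials. The symbol is zero for \<open>n + m - t > N\<close>, in accordance with the
  factor \<open>1 / (N - n - m + t)!\<close> of the moment.\<close>

lemma alpha_eq_moment:
  assumes "t \<le> m" "m \<le> n" "n \<le> N"
  shows "alpha N t m n = moment N 0 n m (int t)"
proof -
  obtain d where m: "m = t + d" using assms(1) le_Suc_ex by blast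
  have p1: "pochhammer (real n + 2) d = fact (n + 1 + d) / fact (n + 1)"
    using pochhammer_of_nat_plus_1[of "n + 1" d] by (simp add: add.commute)
  have p2: "pochhammer (real N + 2 - real t) t = fact (N + 1) / fact (N + 1 - t)"
    using pochhammer_of_nat_plus_1[of "N + 1 - t" t] assms by (simp add: of_nat_diff algebra_simps)
  show ?thesis
  proof (cases "n + d \<le> N")
    case False
    have "pochhammer (real n - real N) d = 0"
      using pochhammer_of_nat_eq_0_lemma[of "N - n" d, where 'a = real] False assms
      by (simp add: of_nat_diff)
    moreover have "racah_term N 0 (int n) (int m) (int t) = 0"
      using False assms m by (intro racah_term_outside) auto
    ultimately show ?thesis by (simp add: alpha_def moment_def m)
  next
    case True
    define u where "u = N - n - d"
    have N: "N = n + d + u" using True by (simp add: u_def)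
    have "pochhammer (real n - real N) d = pochhammer (- (real d + real u)) d"
      by (simp add: N)
    also have "\<dots> = (- 1) ^ d * pochhammer (real u + 1) d"
      using pochhammer_minus[of "real d + real u" d] by (simp add: algebra_simps)
    finally have p3: "pochhammer (real n - real N) d = (- 1) ^ d * (fact (u + d) / fact u)"
      unfolding pochhammer_of_nat_plus_1 .
    have R: "racah_term N 0 (int n) (int m) (int t)
        = 1 / (fact t * fact (n + 1 + d) * fact u * fact (N + 1 - t))"
    proof -
      have "nat (int n + int m + 1 - int t) = n + 1 + d" "nat (int N - int n - int m + int t) = u"
        "nat (int N + 1 - int t) = N + 1 - t"
        using assms by (auto simp: m N)
      then show ?thesis using assms m N
        by (simp add: racah_term_def rise_0 recip_fact_def)
    qed
    have f: "fact (Suc n) = (real n + 1) * fact n" "fact (N + 1) = (real N + 1) * fact N"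
      by (simp_all add: algebra_simps)
    have e: "(- 1 :: real) ^ d * (- 1) ^ d = 1" by (simp flip: power_add mult_2)
    have "alpha N t m n = (real N + 1) / (real n + 1) * (fact (N - m) * fact m / fact N)
        * ((- 1) ^ d * (- 1) ^ d) * ((fact (u + d) / fact u) / (fact (n + 1 + d) / fact (n + 1)))
        * (fact (N + 1) / fact (N + 1 - t) / fact t)"
      unfolding alpha_def p2 using m by (simp add: p1 p3)
    also have "\<dots> = (fact (N + 1) / fact N)\<^sup>2 * (fact m * fact (N - m)) * (fact n * fact (N - n))
        / (fact t * fact (n + 1 + d) * fact u * fact (N + 1 - t))"
    proof -
      have "N - n = u + d" using N by simp
      moreover have *: "K / n1 * (v * m' / F) * 1 * (v' / u' / (w / (n1 * n'))) * (K * F / z / t')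
          = (K * F / F)\<^sup>2 * (m' * v) * (n' * v') / (t' * w * u' * z)"
        if "n1 \<noteq> 0" "F \<noteq> 0" for K n1 v m' F v' u' w n' z t' :: real
        using that by (simp add: divide_simps power2_eq_square)
      have "fact (n + 1) = (real n + 1) * fact n" using f(1) by simp
      ultimately show ?thesis unfolding e f(2)
        by (simp only:) (rule *, simp_all)
    qed
    finally show ?thesis
      unfolding moment_def moment_factor_def R by (simp add: power2_eq_square)
  qed
qed

section \<open>Chebyshev polynomials and the semicircle functional\<close>

lemma sin_mult_cheb_U: "sin \<theta> * poly (cheb_U r) (cos \<theta>) = sin (real (r + 1) * \<theta>)"
proof (induction r rule: cheb_U.induct)
  case (3 r)
  have "sin (real (r + 3) * \<theta>) + sin (real (r + 1) * \<theta>) = 2 * cos \<theta> * sin (real (r + 2) * \<theta>)"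
    using sin_times_cos[of "real (r + 2) * \<theta>" \<theta>] by (simp add: algebra_simps)
  then show ?case using 3 by (simp add: algebra_simps)
qed (simp_all add: sin_double)

text \<open>With \<open>x = cos \<theta>\<close> the integrand becomes \<open>sin ((r + 1)\<theta>) sin ((s + 1)\<theta>)\<close>, half a difference of cosines.
  An antiderivative in \<open>\<theta>\<close>, composed with \<open>arccos\<close>, is continuous on the closed interval, so the
  fundamental theorem applies although \<open>arccos\<close> is not differentiable at the endpoints.\<close>

lemma integral_cheb_U_product:
  "((\<lambda>x. sqrt (1 - x\<^sup>2) * (poly (cheb_U r) x * poly (cheb_U s) x)) has_integral
     (if r = s then pi / 2 else 0)) {-1..1}"
proof -
  define g where "g \<theta> = (if r = s then \<theta> else sin ((real r - real s) * \<theta>) / (real r - real s))" for \<theta> :: real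
  define F where "F \<theta> = (sin (real (r + s + 2) * \<theta>) / real (r + s + 2) - g \<theta>) / 2" for \<theta>
  have g': "(g has_real_derivative cos ((real r - real s) * \<theta>)) (at \<theta>)" for \<theta>
    unfolding g_def by (cases "r = s") (auto intro!: derivative_eq_intros)
  have F': "(F has_real_derivative - (sin (real (r + 1) * \<theta>) * sin (real (s + 1) * \<theta>))) (at \<theta>)" for \<theta>
  proof -
    have "(F has_real_derivative (cos (real (r + s + 2) * \<theta>) - cos ((real r - real s) * \<theta>)) / 2) (at \<theta>)"
      unfolding F_def by (auto intro!: derivative_eq_intros g')
    moreover have "real (r + 1) * \<theta> - real (s + 1) * \<theta> = (real r - real s) * \<theta>"
      "real (r + 1) * \<theta> + real (s + 1) * \<theta> = real (r + s + 2) * \<theta>"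
      by (simp_all add: algebra_simps)
    ultimately show ?thesis
      using sin_times_sin[of "real (r + 1) * \<theta>" "real (s + 1) * \<theta>"]
      by (simp only: minus_divide_left minus_diff_eq)
  qed
  have contF: "continuous_on UNIV F"
    using F' by (meson DERIV_isCont continuous_at_imp_continuous_on)
  have "((\<lambda>x. sqrt (1 - x\<^sup>2) * (poly (cheb_U r) x * poly (cheb_U s) x)) has_integral
      (F (arccos 1) - F (arccos (-1)))) {-1..1}"
  proof (rule fundamental_theorem_of_calculus_interior)
    show "continuous_on {-1..1} (\<lambda>x. F (arccos x))"
      by (rule continuous_on_compose2[OF contF]) (auto intro: continuous_on_arccos')
    fix x :: real assume x: "x \<in> {-1<..<1}"
    define \<theta> where "\<theta> = arccos x"
    have c: "cos \<theta> = x" using x by (simp add: \<theta>_def cos_arccos)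
    have s: "sin \<theta> = sqrt (1 - x\<^sup>2)" using x by (simp add: \<theta>_def sin_arccos)
    have pos: "sqrt (1 - x\<^sup>2) > 0" using x by (simp add: abs_square_less_1 abs_less_iff)
    have "((\<lambda>x. F (arccos x)) has_real_derivative
        - (sin (real (r + 1) * \<theta>) * sin (real (s + 1) * \<theta>)) * inverse (- sqrt (1 - x\<^sup>2))) (at x)"
      unfolding \<theta>_def using x by (intro DERIV_chain2[OF F'] DERIV_arccos) auto
    also have "- (sin (real (r + 1) * \<theta>) * sin (real (s + 1) * \<theta>)) * inverse (- sqrt (1 - x\<^sup>2))
        = sqrt (1 - x\<^sup>2) * (poly (cheb_U r) x * poly (cheb_U s) x)"
      unfolding sin_mult_cheb_U[symmetric] c s using pos by (simp add: field_simps)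
    finally show "((\<lambda>x. F (arccos x)) has_vector_derivative
        sqrt (1 - x\<^sup>2) * (poly (cheb_U r) x * poly (cheb_U s) x)) (at x)"
      by (simp add: has_real_derivative_iff_has_vector_derivative)
  qed simp
  also have "F (arccos 1) - F (arccos (-1)) = (if r = s then pi / 2 else 0)"
  proof -
    have "sin (real (r + s + 2) * pi) = 0" by (rule sin_npi)
    moreover have "sin ((real r - real s) * pi) = 0" by (simp add: left_diff_distrib sin_diff)
    ultimately show ?thesis by (simp add: F_def g_def)
  qed
  finally show ?thesis .
qed

definition cheb_UC :: "nat \<Rightarrow> complex poly" where
  "cheb_UC r = map_poly complex_of_real (cheb_U r)"

lemma poly_cheb_UC: "poly (cheb_UC r) (complex_of_real x) = complex_of_real (poly (cheb_U r) x)"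
  by (simp add: cheb_UC_def)

lemma cheb_UC_recurrence:
  "pCons 0 (smult 2 (cheb_UC k)) = cheb_UC (Suc k) + (if k = 0 then 0 else cheb_UC (k - 1))"
proof (cases k)
  case 0
  then show ?thesis by (simp add: cheb_UC_def map_poly_pCons)
next
  case (Suc r)
  show ?thesis
    unfolding Suc by (rule poly_eqI) (simp add: cheb_UC_def coeff_map_poly coeff_pCons split: nat.splits)
qed

text \<open>The leading coefficient and the degree in one statement, convenient for peeling off the top term.\<close>

lemma coeff_cheb_U: "n \<le> k \<Longrightarrow> coeff (cheb_U n) k = (if k = n then 2 ^ n else 0)"
proof (induction n arbitrary: k rule: cheb_U.induct)
  case (3 r)
  then obtain m where "k = Suc m" by (cases k) auto
  then show ?case using 3 by simp
qed (auto simp: coeff_pCons split: nat.splits)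

lemma coeff_cheb_UC: "n \<le> k \<Longrightarrow> coeff (cheb_UC n) k = (if k = n then 2 ^ n else 0)"
  by (simp add: cheb_UC_def coeff_map_poly coeff_cheb_U)

text \<open>Restricting the functional to polynomials makes it linear without integrability conditions.\<close>

definition semicircle :: "complex poly \<Rightarrow> complex" where
  "semicircle p = integral {-1..1} (\<lambda>x. complex_of_real (sqrt (1 - x\<^sup>2)) * poly p (complex_of_real x))"

lemma semicircle_has_integral:
  "((\<lambda>x. complex_of_real (sqrt (1 - x\<^sup>2)) * poly p (complex_of_real x)) has_integral semicircle p) {-1..1}"
  unfolding semicircle_def
  by (intro integrable_integral integrable_continuous_real) (auto intro!: continuous_intros)

lemma semicircle_add: "semicircle (p + q) = semicircle p + semicircle q"
proof (rule has_integral_unique[OF semicircle_has_integral])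
  show "((\<lambda>x. complex_of_real (sqrt (1 - x\<^sup>2)) * poly (p + q) (complex_of_real x)) has_integral
      semicircle p + semicircle q) {-1..1}"
    using has_integral_add[OF semicircle_has_integral[of p] semicircle_has_integral[of q]]
    by (simp add: algebra_simps)
qed

lemma semicircle_smult: "semicircle (smult c p) = c * semicircle p"
proof (rule has_integral_unique[OF semicircle_has_integral])
  show "((\<lambda>x. complex_of_real (sqrt (1 - x\<^sup>2)) * poly (smult c p) (complex_of_real x)) has_integral
      c * semicircle p) {-1..1}"
    using has_integral_mult_right[OF semicircle_has_integral[of p], of c]
    by (simp add: algebra_simps)
qed

lemma semicircle_0: "semicircle 0 = 0"
  by (simp add: semicircle_def)

lemma semicircle_sum: "semicircle (\<Sum>a\<in>A. f a) = (\<Sum>a\<in>A. semicircle (f a))"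
  by (induction A rule: infinite_finite_induct) (simp_all add: semicircle_0 semicircle_add)

lemma semicircle_diff: "semicircle (p - q) = semicircle p - semicircle q"
  using semicircle_add[of "p - q" q] by simp

lemma semicircle_cnj: "semicircle (map_poly cnj p) = cnj (semicircle p)"
proof (rule has_integral_unique[OF semicircle_has_integral])
  show "((\<lambda>x. complex_of_real (sqrt (1 - x\<^sup>2)) * poly (map_poly cnj p) (complex_of_real x))
      has_integral cnj (semicircle p)) {-1..1}"
    using has_integral_linear[OF semicircle_has_integral[of p] bounded_linear_cnj]
    by (simp add: o_def)
qed

lemma semicircle_cheb_UC: "semicircle (cheb_UC r * cheb_UC s) = (if r = s then complex_of_real (pi / 2) else 0)"
proof -
  have "((\<lambda>x. complex_of_real (sqrt (1 - x\<^sup>2) * (poly (cheb_U r) x * poly (cheb_U s) x))) has_integral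
      complex_of_real (if r = s then pi / 2 else 0)) {-1..1}"
    using has_integral_linear[OF integral_cheb_U_product[of r s] bounded_linear_of_real]
    unfolding o_def .
  from integral_unique[OF this] show ?thesis
    by (simp add: semicircle_def poly_cheb_UC)
qed

section \<open>The weight and the rows of the orthogonal polynomials\<close>

text \<open>The polynomial part of the weight. Taking \<open>min\<close> and \<open>max\<close> builds in the symmetry
  \<open>W\<^sub>n\<^sub>m = W\<^sub>m\<^sub>n\<close>.\<close>

definition weight_poly :: "nat \<Rightarrow> nat \<Rightarrow> nat \<Rightarrow> complex poly" where
  "weight_poly N a b =
     (\<Sum>t = 0..min a b. smult (of_real (alpha N t (min a b) (max a b))) (cheb_UC (a + b - 2 * t)))"

lemma weight_entry_poly:
  assumes "a \<le> N" "b \<le> N"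
  shows "weight N x $$ (a, b) = of_real (sqrt (1 - x\<^sup>2)) * poly (weight_poly N a b) (of_real x)"
  using assms
  by (auto simp: weight_def weight_entry_def weight_poly_def poly_sum poly_cheb_UC min_def max_def add.commute)

lemma weight_poly_commute: "weight_poly N a b = weight_poly N b a"
  by (simp add: weight_poly_def min.commute max.commute add.commute)

lemma map_poly_cnj_weight_poly: "map_poly cnj (weight_poly N a b) = weight_poly N a b"
  by (rule poly_eqI) (simp add: weight_poly_def coeff_map_poly coeff_sum cheb_UC_def)

lemma map_poly_cnj_mult: "map_poly cnj (p * q) = map_poly cnj p * map_poly cnj q"
  by (rule poly_eq_poly_eq_iff[THEN iffD1], rule ext) simp

lemma map_poly_cnj_add: "map_poly cnj (p + q) = map_poly cnj p + map_poly cnj q"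
  by (rule poly_eqI) (simp add: coeff_map_poly)

lemma map_poly_cnj_smult: "map_poly cnj (smult c q) = smult (cnj c) (map_poly cnj q)"
  by (rule poly_eqI) (simp add: coeff_map_poly)

lemma map_poly_cnj_involutive: "map_poly cnj (map_poly cnj p) = p"
  by (rule poly_eqI) (simp add: coeff_map_poly)

lemma semicircle_weight_poly:
  assumes a: "a \<le> N" and b: "b \<le> N"
  shows "semicircle (weight_poly N a b * cheb_UC k) = of_real (pi / 2 * cheb_moment N 0 a b k)"
proof -
  have alpha: "alpha N t (min a b) (max a b) = moment N 0 a b (int t)" if "t \<le> min a b" for t
    using alpha_eq_moment[of t "min a b" "max a b" N] that a b moment_0_commute[of N a b]
    by (cases "a \<le> b") (auto simp: min_def max_def)
  have "semicircle (weight_poly N a b * cheb_UC k)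
      = (\<Sum>t = 0..min a b. of_real (moment N 0 a b (int t)) * (if a + b - 2 * t = k then of_real (pi / 2) else 0))"
    by (simp add: weight_poly_def sum_distrib_right semicircle_sum semicircle_smult semicircle_cheb_UC alpha)
  also have "\<dots> = of_real (pi / 2 * cheb_moment N 0 a b k)"
  proof (cases "\<exists>t\<le>min a b. a + b - 2 * t = k")
    case True
    then obtain t where t: "t \<le> min a b" "a + b - 2 * t = k" by blast
    have "(\<Sum>t = 0..min a b. of_real (moment N 0 a b (int t)) * (if a + b - 2 * t = k then of_real (pi / 2) else 0))
        = (\<Sum>s = 0..min a b. if s = t then of_real (pi / 2 * moment N 0 a b (int t)) else (0 :: complex))"
      using t by (intro sum.cong) auto
    also have "\<dots> = of_real (pi / 2 * moment N 0 a b (int t))"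
      using t by (subst sum.delta) auto
    also have "moment N 0 a b (int t) = cheb_moment N 0 a b k"
      using t by (intro cheb_moment_eq[symmetric]) auto
    finally show ?thesis .
  next
    case False
    have "cheb_moment N 0 a b k = 0"
    proof (cases "even (0 + a + b + k)")
      case True
      then have "even (int 0 + int a + int b - int k)" by presburger
      then obtain t where t: "int 0 + int a + int b - int k = 2 * t" by blast
      have "\<not> (0 \<le> t \<and> t \<le> int (min a b))"
      proof
        assume *: "0 \<le> t \<and> t \<le> int (min a b)"
        then have "nat t \<le> min a b" "a + b - 2 * nat t = k" using t by auto
        then show False using False by blast
      qed
      then have "racah_term N 0 (int a) (int b) t = 0"
        by (intro racah_term_outside) auto
      then show ?thesis using cheb_moment_eq[OF t] by (simp add: moment_def)
    qed (simp add: cheb_moment_odd)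
    then show ?thesis using False by (auto intro!: sum.neutral)
  qed
  finally show ?thesis .
qed

text \<open>The entry \<open>b\<close> of the row vector \<open>\<integral> u W p dx\<close>, for a row \<open>u\<close> and a scalar polynomial \<open>p\<close>. Row vectors are
  functions of the column index; only the columns \<open>\<le> N\<close> count.\<close>

definition row_form :: "nat \<Rightarrow> (nat \<Rightarrow> complex poly) \<Rightarrow> nat \<Rightarrow> complex poly \<Rightarrow> complex" where
  "row_form N u b p = (\<Sum>a\<le>N. semicircle (u a * weight_poly N a b * p))"

lemma row_form_diff_left: "row_form N (\<lambda>a. u a - v a) b p = row_form N u b p - row_form N v b p"
  by (simp add: row_form_def left_diff_distrib semicircle_diff sum_subtractf)

lemma row_form_smult_left: "row_form N (\<lambda>a. smult c (u a)) b p = c * row_form N u b p"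
  by (simp add: row_form_def semicircle_smult sum_distrib_left)

lemma row_form_add_right: "row_form N u b (p + q) = row_form N u b p + row_form N u b q"
  by (simp add: row_form_def distrib_left semicircle_add sum.distrib)

lemma row_form_smult_right: "row_form N u b (smult c p) = c * row_form N u b p"
  by (simp add: row_form_def semicircle_smult sum_distrib_left)

lemma row_form_0_right: "row_form N u b 0 = 0"
  by (simp add: row_form_def semicircle_0)

lemma row_form_pCons_0: "row_form N (\<lambda>a. pCons 0 (u a)) b p = row_form N u b (pCons 0 p)"
  by (simp add: row_form_def)

text \<open>The rows \<open>R\<^sub>n\<^sub>,\<^sub>i\<close>, made from the three-term recurrence. The indices \<open>i = N + 1\<close> and the truncated
  \<open>i - 1\<close>, \<open>n - 1\<close> enter with coefficient zero.\<close>

fun mvop_row :: "nat \<Rightarrow> nat \<Rightarrow> nat \<Rightarrow> nat \<Rightarrow> complex poly" where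
  "mvop_row N 0 i = (\<lambda>a. if a = i then 1 else 0)"
| "mvop_row N (Suc n) i = (\<lambda>a. pCons 0 (mvop_row N n i a)
     - smult (of_real (coeff_up N n i)) (mvop_row N n (i + 1) a)
     - smult (of_real (coeff_down n i)) (mvop_row N n (i - 1) a)
     - smult (of_real (coeff_back N n i)) (mvop_row N (n - 1) i a))"

lemma coeff_mvop_row: "n \<le> k \<Longrightarrow> coeff (mvop_row N n i a) k = (if k = n \<and> a = i then 1 else 0)"
proof (induction n arbitrary: i k rule: less_induct)
  case (less n)
  show ?case
  proof (cases n)
    case 0
    then show ?thesis using less.prems by (auto simp: one_pCons coeff_pCons split: nat.splits)
  next
    case (Suc m)
    then obtain l where l: "k = Suc l" "m \<le> l" using less.prems by (cases k) auto
    show ?thesis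
      using less.IH[of m l i] less.IH[of m k "i + 1"] less.IH[of m k "i - 1"] less.IH[of "m - 1" k i] l
      by (auto simp: Suc)
  qed
qed

text \<open>Multiplication by \<open>x\<close> can be moved from the row to \<open>U\<^sub>k\<close>. Hence both sides satisfy the same recurrence in
  \<open>n\<close>, and they agree for \<open>n = 0\<close>.\<close>

lemma row_form_mvop_row:
  assumes "i \<le> N" and j: "j \<le> N"
  shows "row_form N (mvop_row N n i) j (cheb_UC k) = of_real (pi / 2 * cheb_moment N n i j k)"
  using assms(1)
proof (induction n arbitrary: i k rule: less_induct)
  case (less n)
  show ?case
  proof (cases n)
    case 0
    have "row_form N (mvop_row N 0 i) j (cheb_UC k)
        = (\<Sum>a\<le>N. if a = i then semicircle (weight_poly N i j * cheb_UC k) else 0)"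
      unfolding row_form_def by (intro sum.cong) (auto simp: semicircle_0)
    then show ?thesis using less.prems j 0 by (simp add: semicircle_weight_poly)
  next
    case (Suc m)
    let ?R = "\<lambda>n i k. row_form N (mvop_row N n i) j (cheb_UC k)"
    let ?M = "\<lambda>n i k. cheb_moment N n i j k"
    have IH: "?R l i' k' = of_real (pi / 2 * ?M l i' k')" if "l \<le> m" "i' \<le> N" for l i' k'
      using less.IH[of l i' k'] that Suc by simp
    have up: "of_real (coeff_up N m i) * ?R m (i + 1) k = of_real (pi / 2 * (coeff_up N m i * ?M m (i + 1) k))"
    proof (cases "i = N")
      case True
      then show ?thesis by (simp add: coeff_up_def)
    next
      case False
      then show ?thesis using IH[of m "i + 1" k] less.prems by simp
    qed
    have "2 * row_form N (mvop_row N m i) j (pCons 0 (cheb_UC k))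
        = row_form N (mvop_row N m i) j (pCons 0 (smult 2 (cheb_UC k)))"
      using row_form_smult_right[of N "mvop_row N m i" j 2 "pCons 0 (cheb_UC k)"] by simp
    also have "\<dots> = ?R m i (k + 1) + (if k = 0 then 0 else ?R m i (k - 1))"
      by (simp add: cheb_UC_recurrence row_form_add_right row_form_0_right)
    also have "\<dots> = of_real (pi / 2 * (?M m i (k + 1) + (if k = 0 then 0 else ?M m i (k - 1))))"
      using less.prems by (simp add: IH algebra_simps)
    also have "\<dots> = 2 * of_real (pi / 2 * (?M (Suc m) i k + coeff_up N m i * ?M m (i + 1) k
        + coeff_down m i * ?M m (i - 1) k + coeff_back N m i * ?M (m - 1) i k))"
      using cheb_moment_recurrence[OF less.prems j, of m k] by simp
    finally have "2 * row_form N (mvop_row N m i) j (pCons 0 (cheb_UC k))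
        = 2 * of_real (pi / 2 * (?M (Suc m) i k + coeff_up N m i * ?M m (i + 1) k
        + coeff_down m i * ?M m (i - 1) k + coeff_back N m i * ?M (m - 1) i k))" .
    then have x: "row_form N (mvop_row N m i) j (pCons 0 (cheb_UC k))
        = of_real (pi / 2 * (?M (Suc m) i k + coeff_up N m i * ?M m (i + 1) k
        + coeff_down m i * ?M m (i - 1) k + coeff_back N m i * ?M (m - 1) i k))"
      by (rule mult_left_cancel[THEN iffD1, rotated]) simp
    have down: "?R m (i - 1) k = of_real (pi / 2 * ?M m (i - 1) k)"
      and prev: "?R (m - 1) i k = of_real (pi / 2 * ?M (m - 1) i k)"
      using IH[of m "i - 1" k] IH[of "m - 1" i k] less.prems by simp_all
    have "?R (Suc m) i k = row_form N (mvop_row N m i) j (pCons 0 (cheb_UC k))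
        - of_real (coeff_up N m i) * ?R m (i + 1) k
        - of_real (coeff_down m i) * ?R m (i - 1) k
        - of_real (coeff_back N m i) * ?R (m - 1) i k"
      by (simp only: mvop_row.simps row_form_diff_left row_form_smult_left row_form_pCons_0)
    also have "\<dots> = of_real (pi / 2 * ?M (Suc m) i k)"
      unfolding x up down prev by (simp add: algebra_simps)
    finally show ?thesis by (simp add: Suc)
  qed
qed

section \<open>The squared norms\<close>

definition norm_entry :: "nat \<Rightarrow> nat \<Rightarrow> nat \<Rightarrow> real" where
  "norm_entry N n i = pi / 2
          * ((fact n)\<^sup>2 * (pochhammer (real N + 1) (n + 1))\<^sup>2
             / ((pochhammer (real i + 1) n)\<^sup>2 * (pochhammer (real N - real i + 1) n)\<^sup>2))
          * (2 powi (- 2 * int n) / ((real n + real i + 1) * (real N - real i + real n + 1)))"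

lemma norm_entry_flip: "i \<le> N \<Longrightarrow> norm_entry N n (N - i) = norm_entry N n i"
  by (simp add: norm_entry_def of_nat_diff mult_ac add_ac)

lemma row_form_mvop_row_low:
  assumes "i \<le> N" "j \<le> N" "m \<le> n" "\<And>k. k \<ge> m \<Longrightarrow> coeff p k = 0"
  shows "row_form N (mvop_row N n i) j p = 0"
  using assms(3,4)
proof (induction m arbitrary: p)
  case 0
  then have "p = 0" by (intro poly_eqI) simp
  then show ?case by (simp add: row_form_0_right)
next
  case (Suc m)
  define c where "c = coeff p m / 2 ^ m"
  define q where "q = p - smult c (cheb_UC m)"
  have "coeff q k = 0" if "k \<ge> m" for k
    using that Suc.prems(2)[of k] by (cases "k = m") (simp_all add: q_def c_def coeff_cheb_UC)
  then have "row_form N (mvop_row N n i) j q = 0" using Suc by simp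
  moreover have "row_form N (mvop_row N n i) j (cheb_UC m) = 0"
    unfolding row_form_mvop_row[OF assms(1,2)] using cheb_moment_less[of m n] Suc.prems(1) by simp
  moreover have "p = q + smult c (cheb_UC m)" by (simp add: q_def)
  ultimately show ?case by (simp add: row_form_add_right row_form_smult_right)
qed

text \<open>Only the multiple of \<open>U\<^sub>n\<close> in the Chebyshev expansion of \<open>p\<close> contributes, and it is \<open>2 ^ (- n)\<close> times the
  coefficient of \<open>x ^ n\<close>.\<close>

lemma row_form_mvop_row_top:
  assumes "i \<le> N" "j \<le> N" "\<And>k. k > n \<Longrightarrow> coeff p k = 0"
  shows "row_form N (mvop_row N n i) j p = (if i = j then coeff p n * of_real (norm_entry N n i) else 0)"
proof -
  define c where "c = coeff p n / 2 ^ n"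
  define q where "q = p - smult c (cheb_UC n)"
  have "coeff q k = 0" if "k \<ge> n" for k
    using that assms(3)[of k] by (cases "k = n") (simp_all add: q_def c_def coeff_cheb_UC)
  then have "row_form N (mvop_row N n i) j q = 0" by (rule row_form_mvop_row_low[OF assms(1,2) order_refl])
  moreover have "p = q + smult c (cheb_UC n)" by (simp add: q_def)
  ultimately have "row_form N (mvop_row N n i) j p = c * of_real (pi / 2 * cheb_moment N n i j n)"
    by (simp only: row_form_add_right row_form_smult_right row_form_mvop_row[OF assms(1,2)] add_0_left)
  also have "pi / 2 * cheb_moment N n i j n = (if i = j then 2 ^ n * norm_entry N n i else 0)"
    unfolding cheb_moment_diag[OF assms(1)] norm_entry_def by (simp add: mult_ac)
  finally show ?thesis by (simp add: c_def)
qed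

text \<open>The entry of \<open>\<integral> P W Q\<^sup>* dx\<close> that belongs to a row \<open>u\<close> of \<open>P\<close> and a row \<open>v\<close> of \<open>Q\<close>.\<close>

definition form :: "nat \<Rightarrow> (nat \<Rightarrow> complex poly) \<Rightarrow> (nat \<Rightarrow> complex poly) \<Rightarrow> complex" where
  "form N u v = (\<Sum>b\<le>N. row_form N u b (map_poly cnj (v b)))"

lemma form_add_right: "form N u (\<lambda>b. v b + w b) = form N u v + form N u w"
  by (simp add: form_def map_poly_cnj_add row_form_add_right sum.distrib)

lemma form_smult_right: "form N u (\<lambda>b. smult c (v b)) = cnj c * form N u v"
  by (simp add: form_def map_poly_cnj_smult row_form_smult_right sum_distrib_left)

lemma form_sum_right: "form N u (\<lambda>b. \<Sum>c\<in>A. f c b) = (\<Sum>c\<in>A. form N u (f c))"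
proof (induction A rule: infinite_finite_induct)
  case (insert c A)
  then show ?case by (simp add: form_add_right)
qed (simp_all add: form_def row_form_0_right)

text \<open>The weight is real and symmetric, so the form is Hermitian.\<close>

lemma form_cnj: "cnj (form N u v) = form N v u"
proof -
  have "cnj (semicircle (u a * weight_poly N a b * map_poly cnj (v b)))
      = semicircle (v b * weight_poly N b a * map_poly cnj (u a))" for a b
    by (simp add: semicircle_cnj[symmetric] map_poly_cnj_mult map_poly_cnj_involutive
        map_poly_cnj_weight_poly weight_poly_commute[of N b a] mult_ac)
  then have "cnj (form N u v) = (\<Sum>b\<le>N. \<Sum>a\<le>N. semicircle (v b * weight_poly N b a * map_poly cnj (u a)))"
    by (simp add: form_def row_form_def)
  also have "\<dots> = form N v u"
    unfolding form_def row_form_def by (rule sum.swap)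
  finally show ?thesis .
qed

lemma mat_mult_entry:
  assumes "A \<in> carrier_mat (N + 1) (N + 1)" "B \<in> carrier_mat (N + 1) (N + 1)" "i \<le> N" "j \<le> N"
  shows "(A * B) $$ (i, j) = (\<Sum>a\<le>N. A $$ (i, a) * B $$ (a, j))"
  using assms by (simp add: scalar_prod_def atLeast0LessThan lessThan_Suc_atMost)

lemma mpoly_inner_entry:
  assumes P: "P \<in> carrier_mat (N + 1) (N + 1)" and Q: "Q \<in> carrier_mat (N + 1) (N + 1)"
    and i: "i \<le> N" and j: "j \<le> N"
  shows "mpoly_inner N P Q $$ (i, j) = form N (\<lambda>a. P $$ (i, a)) (\<lambda>b. Q $$ (j, b))"
proof -
  have entry: "(mpoly_eval P x * weight N x * mat_adjoint (mpoly_eval Q x)) $$ (i, j)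
    = (\<Sum>b\<le>N. \<Sum>a\<le>N. of_real (sqrt (1 - x\<^sup>2))
        * poly (P $$ (i, a) * weight_poly N a b * map_poly cnj (Q $$ (j, b))) (of_real x))" for x
  proof -
    have W: "weight N x \<in> carrier_mat (N + 1) (N + 1)" by (simp add: weight_def)
    have adj: "mat_adjoint (mpoly_eval Q x) \<in> carrier_mat (N + 1) (N + 1)"
      using Q by (simp add: mat_adjoint_def mpoly_eval_def mat_of_rows_def)
    have adj': "mat_adjoint (mpoly_eval Q x) $$ (b, j) = cnj (poly (Q $$ (j, b)) (of_real x))"
      if "b \<le> N" for b
      using Q j that by (simp add: mat_adjoint_def mpoly_eval_def mat_of_rows_def)
    have PW: "mpoly_eval P x * weight N x \<in> carrier_mat (N + 1) (N + 1)"
      using P by (simp add: mpoly_eval_def weight_def)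
    have "(mpoly_eval P x * weight N x) $$ (i, b)
        = (\<Sum>a\<le>N. poly (P $$ (i, a)) (of_real x) * weight N x $$ (a, b))" if "b \<le> N" for b
      using P i that by (subst mat_mult_entry[OF _ W]) (simp_all add: mpoly_eval_def)
    then show ?thesis
      by (subst mat_mult_entry[OF PW adj i j]) (simp add: adj' weight_entry_poly sum_distrib_right sum_distrib_left mult_ac cong: sum.cong_simp)
  qed
  have "((\<lambda>x. \<Sum>b\<le>N. \<Sum>a\<le>N. of_real (sqrt (1 - x\<^sup>2))
        * poly (P $$ (i, a) * weight_poly N a b * map_poly cnj (Q $$ (j, b))) (of_real x)) has_integral
      form N (\<lambda>a. P $$ (i, a)) (\<lambda>b. Q $$ (j, b))) {-1..1}"
    unfolding form_def row_form_def by (intro has_integral_sum semicircle_has_integral) auto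
  then show ?thesis
    using i j unfolding mpoly_inner_def mat_integral_def
    by (simp add: entry integral_unique)
qed

lemma monic_mpoly_coeff:
  assumes "monic_mpoly d n P" "i < d" "j < d" "n \<le> k"
  shows "coeff (P $$ (i, j)) k = (if k = n \<and> i = j then 1 else 0)"
proof -
  have P: "P \<in> carrier_mat d d" using assms(1) by (simp add: monic_mpoly_def)
  have "coeff (P $$ (i, j)) k = mpoly_coeff P k $$ (i, j)"
    using P assms(2,3) by (simp add: mpoly_coeff_def)
  also have "mpoly_coeff P k = (if k = n then 1\<^sub>m d else 0\<^sub>m d d)"
    using assms(1,4) by (auto simp: monic_mpoly_def)
  finally show ?thesis using assms(2,3) by simp
qed

context
  fixes N :: nat and P :: "nat \<Rightarrow> complex poly mat"
  assumes mvop: "monic_MVOP N P"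
begin

lemma mvop_carrier: "P n \<in> carrier_mat (N + 1) (N + 1)"
  using mvop by (simp add: monic_MVOP_def monic_mpoly_def)

lemma coeff_mvop:
  "i \<le> N \<Longrightarrow> j \<le> N \<Longrightarrow> n \<le> k \<Longrightarrow> coeff (P n $$ (i, j)) k = (if k = n \<and> i = j then 1 else 0)"
  using mvop monic_mpoly_coeff[of "N + 1" n "P n" i j k] by (simp add: monic_MVOP_def)

lemma form_rows_eq_0:
  assumes "i \<le> N" "j \<le> N" "n \<noteq> m"
  shows "form N (\<lambda>a. P n $$ (i, a)) (\<lambda>b. P m $$ (j, b)) = 0"
  using mvop assms mpoly_inner_entry[OF mvop_carrier mvop_carrier assms(1,2), of n m]
  by (simp add: monic_MVOP_def)

text \<open>The \<open>P\<^sub>m\<close> are monic, so the rows of \<open>P\<^sub>0, \<dots>, P\<^sub>d\<^sub>-\<^sub>1\<close> span all rows of degree below \<open>d\<close>: the induction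
  step removes the coefficient of \<open>x ^ d\<close> with the rows of \<open>P\<^sub>d\<close>.\<close>

lemma form_lower_degree:
  assumes i: "i \<le> N" and "d \<le> n" "\<And>b k. b \<le> N \<Longrightarrow> k \<ge> d \<Longrightarrow> coeff (v b) k = 0"
  shows "form N (\<lambda>a. P n $$ (i, a)) v = 0"
  using assms(2,3)
proof (induction d arbitrary: v)
  case 0
  then have "v b = 0" if "b \<le> N" for b using that by (intro poly_eqI) simp
  then show ?case by (simp add: form_def row_form_0_right)
next
  case (Suc d)
  define w where "w b = (\<Sum>c\<le>N. smult (coeff (v c) d) (P d $$ (c, b)))" for b
  define r where "r b = v b - w b" for b
  have "coeff (r b) k = 0" if b: "b \<le> N" and k: "k \<ge> d" for b k
  proof -
    have "coeff (w b) k = (\<Sum>c\<le>N. if c = b then (if k = d then coeff (v c) d else 0) else 0)"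
      using b k unfolding w_def coeff_sum by (intro sum.cong) (simp_all add: coeff_mvop)
    also have "\<dots> = (if k = d then coeff (v b) d else 0)"
      using b by simp
    finally show ?thesis using Suc.prems(2)[OF b, of k] k by (auto simp: r_def)
  qed
  then have "form N (\<lambda>a. P n $$ (i, a)) r = 0" using Suc by simp
  moreover have "form N (\<lambda>a. P n $$ (i, a)) w = 0"
    using Suc.prems(1) i unfolding w_def form_sum_right form_smult_right
    by (intro sum.neutral) (simp add: form_rows_eq_0)
  moreover have "v = (\<lambda>b. r b + w b)" by (simp add: r_def)
  ultimately show ?case using form_add_right[of N _ r w] by simp
qed

text \<open>In \<open>\<langle>P\<^sub>n\<^sub>,\<^sub>i, P\<^sub>n\<^sub>,\<^sub>j\<rangle>\<close> the second row may be replaced by \<open>R\<^sub>n\<^sub>,\<^sub>j\<close>, which has the same leading coefficient.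
  Then the roles are exchanged: \<open>R\<^sub>n\<^sub>,\<^sub>j\<close> sees nothing of \<open>P\<^sub>n\<^sub>,\<^sub>i\<close> but its leading coefficient.\<close>

lemma sq_norm_entry:
  assumes i: "i \<le> N" and j: "j \<le> N"
  shows "sq_norm N P n $$ (i, j) = (if i = j then of_real (norm_entry N n i) else 0)"
proof -
  let ?p = "\<lambda>i a. P n $$ (i, a)"
  let ?r = "mvop_row N n j"
  have "form N (?p i) (\<lambda>b. ?p j b - ?r b) = 0"
    using i j by (intro form_lower_degree[OF i order_refl]) (auto simp: coeff_mvop coeff_mvop_row)
  moreover have "?p j = (\<lambda>b. (?p j b - ?r b) + ?r b)" by simp
  ultimately have "form N (?p i) (?p j) = form N (?p i) ?r"
    using form_add_right[of N "?p i" "\<lambda>b. ?p j b - ?r b" ?r] by simp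
  also have "\<dots> = cnj (form N ?r (?p i))" by (simp add: form_cnj)
  also have "form N ?r (?p i) = (\<Sum>b\<le>N. if b = j then cnj (coeff (?p i j) n) * of_real (norm_entry N n j) else 0)"
    unfolding form_def using i j
    by (intro sum.cong) (auto simp: row_form_mvop_row_top coeff_map_poly coeff_mvop)
  also have "\<dots> = (if i = j then of_real (norm_entry N n j) else 0)"
    using i j by (simp add: coeff_mvop)
  finally show ?thesis
    unfolding sq_norm_def mpoly_inner_entry[OF mvop_carrier mvop_carrier i j] by auto
qed

end

lemma flip_mat_conjugate:
  assumes A: "A \<in> carrier_mat (N + 1) (N + 1)" and i: "i \<le> N" and j: "j \<le> N"
  shows "(flip_mat N * A * flip_mat N) $$ (i, j) = A $$ (N - i, N - j)"
proof -
  have F: "flip_mat N \<in> carrier_mat (N + 1) (N + 1)" by (simp add: flip_mat_def)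
  have flip: "flip_mat N $$ (a, b) = (if a + b = N then 1 else 0)" if "a \<le> N" "b \<le> N" for a b
    using that by (simp add: flip_mat_def)
  have FA: "flip_mat N * A \<in> carrier_mat (N + 1) (N + 1)" using F A by simp
  have 1: "(flip_mat N * A) $$ (i, b) = A $$ (N - i, b)" if "b \<le> N" for b
  proof -
    have "(flip_mat N * A) $$ (i, b) = (\<Sum>a\<le>N. if a = N - i then A $$ (N - i, b) else 0)"
      unfolding mat_mult_entry[OF F A i that]
      using i by (intro sum.cong) (auto simp: flip)
    then show ?thesis by simp
  qed
  have "(flip_mat N * A * flip_mat N) $$ (i, j)
      = (\<Sum>b\<le>N. if b = N - j then A $$ (N - i, N - j) else 0)"
    unfolding mat_mult_entry[OF FA F i j]
    using j by (intro sum.cong) (auto simp: flip 1)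
  then show ?thesis by simp
qed

theorem corollary5p4:
  fixes N :: nat and P :: "nat \<Rightarrow> complex poly mat"
  assumes "monic_MVOP N P"
  shows "\<forall>n. (\<forall>i\<in>{0..N}. \<forall>j\<in>{0..N}. sq_norm N P n $$ (i, j) =
      (if i = j then complex_of_real
         (pi / 2
          * ((fact n)\<^sup>2 * (pochhammer (real N + 1) (n + 1))\<^sup>2
             / ((pochhammer (real i + 1) n)\<^sup>2 * (pochhammer (real N - real i + 1) n)\<^sup>2))
          * (2 powi (- 2 * int n) / ((real n + real i + 1) * (real N - real i + real n + 1))))
       else 0))
    \<and> flip_mat N * sq_norm N P n * flip_mat N = sq_norm N P n"
proof (intro allI conjI)
  fix n
  note entry = sq_norm_entry[OF assms, of _ _ n]
  show "\<forall>i\<in>{0..N}. \<forall>j\<in>{0..N}. sq_norm N P n $$ (i, j) =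
      (if i = j then complex_of_real
         (pi / 2
          * ((fact n)\<^sup>2 * (pochhammer (real N + 1) (n + 1))\<^sup>2
             / ((pochhammer (real i + 1) n)\<^sup>2 * (pochhammer (real N - real i + 1) n)\<^sup>2))
          * (2 powi (- 2 * int n) / ((real n + real i + 1) * (real N - real i + real n + 1))))
       else 0)"
    by (simp only: norm_entry_def[symmetric]) (simp add: entry)
  have H: "sq_norm N P n \<in> carrier_mat (N + 1) (N + 1)"
    by (simp add: sq_norm_def mpoly_inner_def mat_integral_def)
  show "flip_mat N * sq_norm N P n * flip_mat N = sq_norm N P n"
  proof (rule eq_matI)
    fix i j assume "i < dim_row (sq_norm N P n)" "j < dim_col (sq_norm N P n)"
    then have ij: "i \<le> N" "j \<le> N" using H by auto
    show "(flip_mat N * sq_norm N P n * flip_mat N) $$ (i, j) = sq_norm N P n $$ (i, j)"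
      unfolding flip_mat_conjugate[OF H ij] using ij
      by (auto simp: entry norm_entry_flip)
  qed (use H in \<open>simp_all add: flip_mat_def\<close>)
qed

end
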